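(* Let $\psi$ be a target pure state on $\mathcal H$, $m\ge1$ an integer, $\varepsilon\in[0,1)$, and $\rho$ a density operator on $\mathcal H_{\rm in}$. Let $\mathcal O$ be the set of free operations of a resource theory with free states $\mathcal F$. Suppose a free generalized twirling operation exists, i.e. there is a free state $\sigma^\star\in\mathcal F$ (on $\mathcal H^{\otimes m}$) such that the map $$\mathcal T(X)=\operatorname{Tr}[\psi^{\otimes m}X]\,\psi^{\otimes m}+\operatorname{Tr}[(I-\psi^{\otimes m})X]\,\sigma^\star$$ on operators on $\mathcal H^{\otimes m}$ belongs to $\mathcal O$. Then $$C^\varepsilon(\rho,m)=\max\left\{\frac{2(1-\varepsilon)}{f_{\mathcal O}(\rho,m)}-1,\;1\right\},$$ where $C^\varepsilon(\rho,m)$ is the virtual distillation overhead with respect to $\mathcal O$ and $f_{\mathcal O}(\rho,m)=\max_{\Lambda\in\mathcal O}\operatorname{Tr}[\Lambda(\rho)\psi^{\otimes m}]$.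
   Context: All Hilbert spaces are finite-dimensional. A resource theory of states consists of a set $\mathcal F$ of density operators, called free states (specified for each system under consideration, here $\mathcal H_{\rm in}$ and $\mathcal H^{\otimes m}$), and a set $\mathcal O$ of free operations, which are completely positive trace-preserving maps between these systems satisfying $\Lambda(\sigma)\in\mathcal F$ for all $\sigma\in\mathcal F$ (with the free states of the respective input and output spaces). The set $\mathcal O$ need not consist of all maps that preserve $\mathcal F$. Virtual distillation overhead with respect to $\mathcal O$: $$C^\varepsilon(\rho,m)=\inf\Big\{\lambda_++\lambda_- \;:\; \lambda_\pm\ge0,\ \lambda_+-\lambda_-=1,\ \Lambda_\pm\in\mathcal O,\ \tfrac12\big\|\lambda_+\Lambda_+(\rho)-\lambda_-\Lambda_-(\rho)-\psi^{\otimes m}\big\|_1\le\varepsilon\Big\},$$ where $\Lambda_\pm$ range over the elements of $\mathcal O$ mapping operators on $\mathcal H_{\rm in}$ to operators on $\mathcal H^{\otimes m}$, and $\|A\|_1=\operatorname{Tr}\sqrt{A^\dagger A}$. The maximum defining $f_{\mathcal O}(\rho,m)$ is over the same operations $\Lambda\in\mathcal O$ from $\mathcal H_{\rm in}$ to $\mathcal H^{\otimes m}$. Here $\psi$ denotes the rank-one projector $|\psi\rangle\langle\psi|$. Conventions: the infimum over an empty set is $+\infty$, and $2(1-\varepsilon)/0=+\infty$.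
   Formalization: Added assumptions: free operations from H_in to H^{⊗m} are closed under composition with free operations on H^{⊗m}, and discarding the input and preparing any free state of H^{⊗m} is free; without either the formula can fail. The maximum f_O is read as a supremum. *)

theory Defs
  imports "HOL-Analysis.Analysis"
begin

text \<open>
  Operators on a \<open>d\<close>-dimensional Hilbert space are complex square matrices over an index type
  with \<open>d\<close> elements.  If \<open>'n\<close> indexes a basis of \<open>H\<close>, the \<open>m\<close>-fold tensor power of \<open>H\<close> has a
  basis indexed by functions \<open>'m \<Rightarrow> 'n\<close>, where \<open>CARD('m) = m \<ge> 1\<close>.
\<close>

type_synonym 'n cmat = "complex ^ 'n ^ 'n"

definition mscale :: "complex \<Rightarrow> 'n::finite cmat \<Rightarrow> 'n cmat"
  where "mscale c A = (\<chi> i j. c * A $ i $ j)"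

definition dagger :: "'n::finite cmat \<Rightarrow> 'n cmat"
  where "dagger A = (\<chi> i j. cnj (A $ j $ i))"

definition cip :: "complex ^ 'n::finite \<Rightarrow> complex ^ 'n \<Rightarrow> complex"
  where "cip u v = (\<Sum>i\<in>UNIV. cnj (u $ i) * v $ i)"

text \<open>Over the complex numbers, a real quadratic form forces \<open>A\<close> to be Hermitian.\<close>

definition psd :: "'n::finite cmat \<Rightarrow> bool"
  where "psd A \<longleftrightarrow> (\<forall>v. cip v (A *v v) \<in> \<real>\<^sub>\<ge>\<^sub>0)"

definition density_op :: "'n::finite cmat \<Rightarrow> bool"
  where "density_op A \<longleftrightarrow> psd A \<and> trace A = 1"

text \<open>Every positive semidefinite matrix has exactly one positive semidefinite square root; the
  value is irrelevant for other arguments.\<close>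

definition psd_sqrt :: "'n::finite cmat \<Rightarrow> 'n cmat"
  where "psd_sqrt A = (THE B. psd B \<and> B ** B = A)"

definition trace_norm :: "'n::finite cmat \<Rightarrow> real"
  where "trace_norm A = Re (trace (psd_sqrt (dagger A ** A)))"

text \<open>For a unit vector \<open>v\<close> this is the rank-one projector onto the line spanned by \<open>v\<close>.\<close>

definition ketbra :: "complex ^ 'n::finite \<Rightarrow> 'n cmat"
  where "ketbra v = (\<chi> i j. v $ i * cnj (v $ j))"

definition tensor_pow :: "'n::finite cmat \<Rightarrow> ('m::finite \<Rightarrow> 'n) cmat"
  where "tensor_pow A = (\<chi> f g. \<Prod>k\<in>UNIV. A $ f k $ g k)"

text \<open>
  Complete positivity: for each \<open>k\<close>, the map \<open>id \<otimes> \<Lambda>\<close> on \<open>k \<times> k\<close> block matrices preserves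
  positive semidefiniteness.  The block matrix is the family \<open>X a b\<close> with \<open>a, b < k\<close>, and a
  vector of the enlarged space is a family \<open>v a\<close> with \<open>a < k\<close>; values at larger indices are
  never used.
\<close>

definition block_psd :: "nat \<Rightarrow> (nat \<Rightarrow> nat \<Rightarrow> 'n::finite cmat) \<Rightarrow> bool"
  where "block_psd k X \<longleftrightarrow>
    (\<forall>v. (\<Sum>a<k. \<Sum>b<k. cip (v a) (X a b *v v b)) \<in> \<real>\<^sub>\<ge>\<^sub>0)"

definition completely_positive :: "('i::finite cmat \<Rightarrow> 'o::finite cmat) \<Rightarrow> bool"
  where "completely_positive \<Lambda> \<longleftrightarrow>
    (\<forall>k X. block_psd k X \<longrightarrow> block_psd k (\<lambda>a b. \<Lambda> (X a b)))"

definition cptp :: "('i::finite cmat \<Rightarrow> 'o::finite cmat) \<Rightarrow> bool"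
  where "cptp \<Lambda> \<longleftrightarrow> Vector_Spaces.linear mscale mscale \<Lambda> \<and> completely_positive \<Lambda> \<and>
    (\<forall>X. trace (\<Lambda> X) = trace X)"

text \<open>
  \<open>F\<close> and \<open>G\<close> are the free states of the input and output systems, \<open>Ops\<close> a set of operations
  between them.  \<open>Ops\<close> need not contain all maps that preserve free states.
\<close>

definition free_operations ::
    "'i::finite cmat set \<Rightarrow> 'o::finite cmat set \<Rightarrow> ('i cmat \<Rightarrow> 'o cmat) set \<Rightarrow> bool"
  where "free_operations F G Ops \<longleftrightarrow>
    (\<forall>\<sigma>\<in>F. density_op \<sigma>) \<and> (\<forall>\<sigma>\<in>G. density_op \<sigma>) \<and>
    (\<forall>\<Lambda>\<in>Ops. cptp \<Lambda> \<and> (\<forall>\<sigma>\<in>F. \<Lambda> \<sigma> \<in> G))"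

definition prepare :: "'o::finite cmat \<Rightarrow> 'i::finite cmat \<Rightarrow> 'o cmat"
  where "prepare \<sigma> X = mscale (trace X) \<sigma>"

definition twirl :: "'n::finite cmat \<Rightarrow> 'n cmat \<Rightarrow> 'n cmat \<Rightarrow> 'n cmat"
  where "twirl P \<sigma> X = mscale (trace (P ** X)) P + mscale (trace ((mat 1 - P) ** X)) \<sigma>"

text \<open>The infimum is taken in \<^typ>\<open>ereal\<close>, so that it is \<open>\<infinity>\<close> when no decomposition exists.\<close>

definition virtual_overhead ::
    "('i::finite cmat \<Rightarrow> ('m::finite \<Rightarrow> 'n::finite) cmat) set \<Rightarrow> complex ^ 'n \<Rightarrow> real \<Rightarrow>
     'i cmat \<Rightarrow> ereal"
  where "virtual_overhead Ops \<psi> \<epsilon> \<rho> =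
    Inf {ereal (lp + lm) | lp lm \<Lambda>p \<Lambda>m.
      0 \<le> lp \<and> 0 \<le> lm \<and> lp - lm = 1 \<and> \<Lambda>p \<in> Ops \<and> \<Lambda>m \<in> Ops \<and>
      1 / 2 * trace_norm (lp *\<^sub>R \<Lambda>p \<rho> - lm *\<^sub>R \<Lambda>m \<rho> - tensor_pow (ketbra \<psi>)) \<le> \<epsilon>}"

text \<open>A supremum, so that the value is defined whether or not an optimal operation exists; it is
  the maximum whenever there is one.\<close>

definition max_overlap ::
    "('i::finite cmat \<Rightarrow> ('m::finite \<Rightarrow> 'n::finite) cmat) set \<Rightarrow> complex ^ 'n \<Rightarrow>
     'i cmat \<Rightarrow> ereal"
  where "max_overlap Ops \<psi> \<rho> =
    (SUP \<Lambda>\<in>Ops. ereal (Re (trace (\<Lambda> \<rho> ** tensor_pow (ketbra \<psi>)))))"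

text \<open>With the library's conventions for \<^typ>\<open>ereal\<close>, a positive real divided by \<open>0\<close> is \<open>\<infinity>\<close>.\<close>

lemma ereal_pos_divide_zero: "0 < r \<Longrightarrow> ereal r / 0 = \<infinity>"
  by (simp add: divide_ereal_def zero_ereal_def[symmetric])

end

theory Submission
  imports Defs
begin

text \<open>
  Write \<open>P\<close> for the projector onto the target and \<open>f\<close> for the maximal overlap.  If
  \<open>\<lambda>\<^sub>+ \<Lambda>\<^sub>+(\<rho>) - \<lambda>\<^sub>- \<Lambda>\<^sub>-(\<rho>)\<close> is \<open>\<epsilon>\<close>-close to \<open>P\<close>, then, as the difference is Hermitian and
  traceless, its expectation in the target is at least \<open>- \<epsilon>\<close>, so \<open>\<lambda>\<^sub>+ f \<ge> 1 - \<epsilon>\<close>.  Conversely,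
  twirling an operation of overlap \<open>p\<close> gives the state \<open>p P + (1 - p) \<sigma>\<close>, and subtracting the
  prepared state \<open>\<sigma>\<close> with \<open>\<lambda>\<^sub>+ = max ((1 - \<epsilon>) / p) 1\<close> leaves the error \<open>c (\<sigma> - P)\<close> with
  \<open>c = 1 - \<lambda>\<^sub>+ p \<in> [0, \<epsilon>]\<close>.  Both directions read the trace norm of a Hermitian matrix off its
  eigenvalues.
\<close>

section \<open>The Hermitian form\<close>

lemma cip_add_left: "cip (u + v) w = cip u w + cip v w"
  by (simp add: cip_def algebra_simps sum.distrib)

lemma cip_add_right: "cip u (v + w) = cip u v + cip u w"
  by (simp add: cip_def algebra_simps sum.distrib)

lemma cip_diff_right: "cip u (v - w) = cip u v - cip u w"
  by (simp add: cip_def algebra_simps sum_subtractf)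

lemma cip_scale_left: "cip (c *s u) v = cnj c * cip u v"
  by (simp add: cip_def algebra_simps sum_distrib_left)

lemma cip_scale_right: "cip u (c *s v) = c * cip u v"
  by (simp add: cip_def algebra_simps sum_distrib_left)

lemma cip_zero_right [simp]: "cip u 0 = 0"
  by (simp add: cip_def)

lemma cip_sum_right: "cip u (\<Sum>i\<in>S. f i) = (\<Sum>i\<in>S. cip u (f i))"
  by (induction S rule: infinite_finite_induct) (simp_all add: cip_add_right)

lemma cip_commute: "cip u v = cnj (cip v u)"
  by (simp add: cip_def algebra_simps)

lemma cip_self: "cip v v = complex_of_real ((norm v)\<^sup>2)"
  by (simp add: cip_def norm_vec_def L2_set_def sum_nonneg complex_norm_square algebra_simps
      flip: of_real_power)

lemma cip_self_eq_0_iff: "cip v v = 0 \<longleftrightarrow> v = 0"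
  by (simp add: cip_self)

lemma cip_mult_commute: "cip u v * cip v u = complex_of_real ((cmod (cip u v))\<^sup>2)"
  by (subst (2) cip_commute) (rule complex_norm_square[symmetric])

lemma cip_dagger: "cip (dagger A *v u) v = cip u (A *v v)"
proof -
  have "cip (dagger A *v u) v = (\<Sum>i\<in>UNIV. \<Sum>j\<in>UNIV. A $ j $ i * cnj (u $ j) * v $ i)"
    by (simp add: cip_def dagger_def matrix_vector_mult_def sum_distrib_right)
  also have "\<dots> = (\<Sum>j\<in>UNIV. \<Sum>i\<in>UNIV. A $ j $ i * cnj (u $ j) * v $ i)"
    by (rule sum.swap)
  also have "\<dots> = cip u (A *v v)"
    by (simp add: cip_def matrix_vector_mult_def sum_distrib_left mult_ac)
  finally show ?thesis .
qed

lemma cip_hermitian: "dagger A = A \<Longrightarrow> cip (A *v u) v = cip u (A *v v)"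
  using cip_dagger[of A u v] by simp

lemma dagger_mat_1: "dagger (mat 1) = mat 1"
  by (simp add: dagger_def mat_def vec_eq_iff)

lemma mscale_vector_mult: "mscale c A *v v = c *s (A *v v)"
  by (simp add: mscale_def vec_eq_iff matrix_vector_mult_def sum_distrib_left mult_ac)

lemma scaleR_eq_mscale: "r *\<^sub>R A = mscale (complex_of_real r) A"
  by (simp add: mscale_def vec_eq_iff scaleR_conv_of_real[where 'a = complex])

lemma vector_mult_scale: "(A :: 'n::finite cmat) *v (c *s v) = c *s (A *v v)"
  by (simp add: vec_eq_iff matrix_vector_mult_def sum_distrib_left mult_ac)

text \<open>The two cross terms are complex conjugates, so their real parts agree and merge into the
  linear coefficient. Taking \<open>A = mat 1\<close> gives the expansion of the squared norm along
  the same line.\<close>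

lemma hermitian_quadratic_line:
  assumes "dagger A = A"
  shows "Re (cip (v + complex_of_real t *s w) (A *v (v + complex_of_real t *s w)))
    = Re (cip v (A *v v)) + 2 * t * Re (cip w (A *v v)) + t\<^sup>2 * Re (cip w (A *v w))"
proof -
  have "Re (cip v (A *v w)) = Re (cip w (A *v v))"
    using cip_commute[of v "A *v w"] cip_hermitian[OF assms, of w v] by simp
  then show ?thesis
    by (simp add: cip_add_left cip_add_right cip_scale_left cip_scale_right vector_mult_scale
        matrix_vector_right_distrib power2_eq_square algebra_simps)
qed

lemma dagger_diff: "dagger (A - B) = dagger A - dagger B"
  by (simp add: dagger_def vec_eq_iff)

lemma dagger_scaleR: "dagger (r *\<^sub>R A) = r *\<^sub>R dagger A"
  by (simp add: dagger_def vec_eq_iff scaleR_conv_of_real[where 'a = complex])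

lemma trace_diff: "trace (A - B :: 'n::finite cmat) = trace A - trace B"
  by (simp add: trace_def sum_subtractf)

lemma trace_scaleR: "trace (r *\<^sub>R A :: 'n::finite cmat) = of_real r * trace A"
  by (simp add: trace_def sum_distrib_left scaleR_conv_of_real[where 'a = complex])

section \<open>Positive semidefinite matrices\<close>

lemma psd_cip: "psd A \<Longrightarrow> cip v (A *v v) = complex_of_real (Re (cip v (A *v v)))"
  by (simp add: psd_def complex_nonneg_Reals_iff complex_eq_iff)

lemma psd_Re_nonneg: "psd A \<Longrightarrow> 0 \<le> Re (cip v (A *v v))"
  by (auto simp add: psd_def complex_nonneg_Reals_iff)

lemma psdI: "(\<And>v. cip v (A *v v) = complex_of_real (f v)) \<Longrightarrow> (\<And>v. 0 \<le> f v) \<Longrightarrow> psd A"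
  by (simp add: psd_def complex_nonneg_Reals_iff)

text \<open>Polarization with \<open>v + w\<close> and \<open>v + \<i> w\<close>.\<close>

lemma psd_hermitian:
  assumes "psd A" shows "dagger A = A"
proof -
  have im: "Im (cip v (A *v v)) = 0" for v
    using assms by (auto simp add: psd_def complex_nonneg_Reals_iff)
  have sym: "cip w (A *v v) = cip (A *v w) v" for v w
  proof -
    have "Im (cip v (A *v w)) + Im (cip w (A *v v)) = 0"
      using im[of "v + w"] im[of v] im[of w]
      by (simp add: cip_add_left cip_add_right matrix_vector_right_distrib)
    moreover have "Re (cip v (A *v w)) - Re (cip w (A *v v)) = 0"
      using im[of "v + \<i> *s w"] im[of v] im[of w]
      by (simp add: cip_add_left cip_add_right matrix_vector_right_distrib vector_mult_scale
          cip_scale_left cip_scale_right)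
    ultimately have "cip w (A *v v) = cnj (cip v (A *v w))"
      by (simp add: complex_eq_iff)
    then show ?thesis
      using cip_commute by metis
  qed
  have "dagger A *v u = A *v u" for u
  proof -
    have "cip (dagger A *v u) v = cip (A *v u) v" for v
      by (simp add: cip_dagger sym)
    then have "cip v (dagger A *v u - A *v u) = 0" for v
      using cip_commute by (metis cip_diff_right cancel_comm_monoid_add_class.diff_cancel)
    then show ?thesis
      using cip_self_eq_0_iff by (metis eq_iff_diff_eq_0)
  qed
  then show ?thesis
    by (simp add: matrix_eq)
qed

lemma psd_scaleR:
  assumes "psd A" "0 \<le> r" shows "psd (r *\<^sub>R A)"
proof (rule psdI)
  show "cip v (r *\<^sub>R A *v v) = complex_of_real (r * Re (cip v (A *v v)))" for v
    using psd_cip[OF assms(1), of v]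
    by (simp add: scaleR_eq_mscale mscale_vector_mult cip_scale_right)
  show "0 \<le> r * Re (cip v (A *v v))" for v
    using assms psd_Re_nonneg by (simp add: psd_Re_nonneg)
qed

lemma ketbra_vector_mult: "ketbra u *v v = cip u v *s u"
  by (simp add: ketbra_def cip_def matrix_vector_mult_def vec_eq_iff sum_distrib_left mult_ac)

lemma trace_ketbra_mult: "trace (ketbra u ** A) = cip u (A *v u)"
proof -
  have "trace (ketbra u ** A) = (\<Sum>i\<in>UNIV. \<Sum>j\<in>UNIV. u $ i * cnj (u $ j) * A $ j $ i)"
    by (simp add: trace_def matrix_matrix_mult_def ketbra_def)
  also have "\<dots> = (\<Sum>j\<in>UNIV. \<Sum>i\<in>UNIV. u $ i * cnj (u $ j) * A $ j $ i)"
    by (rule sum.swap)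
  also have "\<dots> = cip u (A *v u)"
    by (simp add: cip_def matrix_vector_mult_def sum_distrib_left mult_ac)
  finally show ?thesis .
qed

lemma trace_ketbra: "trace (ketbra u) = complex_of_real ((norm u)\<^sup>2)"
  using trace_ketbra_mult[of u "mat 1"] by (simp add: cip_self)

lemma psd_ketbra: "psd (ketbra u)"
proof (rule psdI)
  show "cip v (ketbra u *v v) = complex_of_real ((cmod (cip u v))\<^sup>2)" for v
    by (simp only: ketbra_vector_mult cip_scale_right cip_mult_commute)
qed simp

section \<open>Orthonormal bases and the spectral theorem\<close>

definition orthonormal_on :: "'k set \<Rightarrow> ('k \<Rightarrow> complex ^ 'n::finite) \<Rightarrow> bool"
  where "orthonormal_on J e \<longleftrightarrow> (\<forall>i\<in>J. \<forall>j\<in>J. cip (e i) (e j) = (if i = j then 1 else 0))"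

abbreviation eigenbasis :: "'n::finite cmat \<Rightarrow> ('n \<Rightarrow> complex ^ 'n) \<Rightarrow> ('n \<Rightarrow> real) \<Rightarrow> bool"
  where "eigenbasis A e d \<equiv>
    orthonormal_on UNIV e \<and> (\<forall>i. A *v e i = complex_of_real (d i) *s e i)"

text \<open>The completeness relation: orthonormality says that the adjoint of the square matrix
  with columns \<open>e k\<close> is a left inverse, hence also a right inverse.\<close>

lemma orthonormal_outer_sum:
  fixes e :: "'n::finite \<Rightarrow> complex ^ 'n"
  assumes "orthonormal_on UNIV e"
  shows "(\<Sum>k\<in>UNIV. e k $ i * cnj (e k $ j)) = (if i = j then 1 else 0)"
proof -
  define Q :: "'n cmat" where "Q = (\<chi> i j. e j $ i)"
  have "dagger Q ** Q = mat 1"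
    using assms
    by (simp add: Q_def dagger_def matrix_matrix_mult_def mat_def vec_eq_iff orthonormal_on_def
        cip_def)
  then have "Q ** dagger Q = mat 1"
    by (simp add: matrix_left_right_inverse)
  then have "(Q ** dagger Q) $ i $ j = mat 1 $ i $ j"
    by simp
  then show ?thesis
    by (simp add: Q_def dagger_def matrix_matrix_mult_def mat_def)
qed

text \<open>Basis independence of the trace: once the sum over \<open>k\<close> is moved innermost,
  completeness collapses it to a Kronecker delta.\<close>

lemma orthonormal_trace:
  fixes e :: "'n::finite \<Rightarrow> complex ^ 'n"
  assumes "orthonormal_on UNIV e"
  shows "trace A = (\<Sum>k\<in>UNIV. cip (e k) (A *v e k))"
proof -
  have "(\<Sum>k\<in>UNIV. cip (e k) (A *v e k))
      = (\<Sum>k\<in>UNIV. \<Sum>i\<in>UNIV. \<Sum>j\<in>UNIV. A $ i $ j * (e k $ j * cnj (e k $ i)))"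
    by (simp add: cip_def matrix_vector_mult_def sum_distrib_left mult_ac)
  also have "\<dots> = (\<Sum>i\<in>UNIV. \<Sum>k\<in>UNIV. \<Sum>j\<in>UNIV. A $ i $ j * (e k $ j * cnj (e k $ i)))"
    by (rule sum.swap)
  also have "\<dots> = (\<Sum>i\<in>UNIV. \<Sum>j\<in>UNIV. \<Sum>k\<in>UNIV. A $ i $ j * (e k $ j * cnj (e k $ i)))"
    by (intro sum.cong refl sum.swap)
  also have "\<dots> = trace A"
    by (simp add: orthonormal_outer_sum[OF assms] trace_def if_distrib cong: if_cong
        flip: sum_distrib_left)
  finally show ?thesis ..
qed

lemma orthonormal_expansion:
  fixes e :: "'n::finite \<Rightarrow> complex ^ 'n"
  assumes "orthonormal_on UNIV e"
  shows "v = (\<Sum>k\<in>UNIV. cip (e k) v *s e k)"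
proof -
  have "(\<Sum>k\<in>UNIV. cip (e k) v *s e k) $ i = v $ i" for i
  proof -
    have "(\<Sum>k\<in>UNIV. cip (e k) v *s e k) $ i
        = (\<Sum>k\<in>UNIV. \<Sum>j\<in>UNIV. v $ j * (e k $ i * cnj (e k $ j)))"
      by (simp add: cip_def sum_distrib_left sum_distrib_right mult_ac)
    also have "\<dots> = (\<Sum>j\<in>UNIV. \<Sum>k\<in>UNIV. v $ j * (e k $ i * cnj (e k $ j)))"
      by (rule sum.swap)
    also have "\<dots> = v $ i"
      by (simp add: orthonormal_outer_sum[OF assms] if_distrib cong: if_cong
          flip: sum_distrib_left)
    finally show ?thesis .
  qed
  then show ?thesis
    by (simp add: vec_eq_iff)
qed

lemma vector_mult_sum: "(A :: 'n::finite cmat) *v (\<Sum>i\<in>S. f i) = (\<Sum>i\<in>S. A *v f i)"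
  by (induction S rule: infinite_finite_induct) (simp_all add: matrix_vector_right_distrib)

lemma matrix_eq_on_orthonormal:
  fixes e :: "'n::finite \<Rightarrow> complex ^ 'n" and A B :: "'n cmat"
  assumes "orthonormal_on UNIV e" "\<And>i. A *v e i = B *v e i"
  shows "A = B"
  unfolding matrix_eq
proof
  fix v
  have "M *v v = (\<Sum>k\<in>UNIV. cip (e k) v *s (M *v e k))" for M :: "'n cmat"
    by (subst orthonormal_expansion[OF assms(1), of v]) (simp add: vector_mult_sum vector_mult_scale)
  then show "A *v v = B *v v"
    using assms(2) by simp
qed

lemma eigenbasis_cip:
  assumes "eigenbasis A e d"
  shows "cip v (A *v v) = complex_of_real (\<Sum>k\<in>UNIV. d k * (cmod (cip (e k) v))\<^sup>2)"
proof -
  have "A *v v = (\<Sum>k\<in>UNIV. cip (e k) v *s (complex_of_real (d k) *s e k))"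
    using assms by (subst orthonormal_expansion[of e v])
      (simp_all add: vector_mult_sum vector_mult_scale)
  then have "cip v (A *v v) = (\<Sum>k\<in>UNIV. complex_of_real (d k) * (cip (e k) v * cip v (e k)))"
    by (simp add: cip_sum_right cip_scale_right mult_ac)
  then show ?thesis
    by (simp add: cip_mult_commute)
qed

lemma orthonormal_parseval:
  fixes e :: "'n::finite \<Rightarrow> complex ^ 'n"
  assumes "orthonormal_on UNIV e"
  shows "(\<Sum>k\<in>UNIV. (cmod (cip (e k) v))\<^sup>2) = (norm v)\<^sup>2"
proof -
  \<comment> \<open>The identity has every orthonormal basis as an eigenbasis, with all eigenvalues
    1.\<close>
  have "complex_of_real (\<Sum>k\<in>UNIV. 1 * (cmod (cip (e k) v))\<^sup>2) = cip v (mat 1 *v v)"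
    using assms by (intro eigenbasis_cip[symmetric]) simp
  then have "complex_of_real (\<Sum>k\<in>UNIV. (cmod (cip (e k) v))\<^sup>2) = complex_of_real ((norm v)\<^sup>2)"
    by (simp add: cip_self)
  then show ?thesis
    by (simp only: of_real_eq_iff)
qed

lemma eigenbasis_trace:
  assumes "eigenbasis A e d"
  shows "trace A = complex_of_real (\<Sum>k\<in>UNIV. d k)"
  using assms orthonormal_trace[of e A]
  by (simp add: cip_scale_right orthonormal_on_def)

lemma eigenbasis_eigenvalue:
  assumes "eigenbasis A e d"
  shows "cip (e k) (A *v e k) = complex_of_real (d k)"
  using assms by (simp add: cip_scale_right orthonormal_on_def)

text \<open>A dimension count in matrix form: stacking the conjugated vectors as rows leaves row
  \<open>i\<close> zero, so the square matrix is singular, and any kernel vector is orthogonal to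
  the family.\<close>

lemma exists_orthogonal_vector:
  fixes e :: "'n::finite \<Rightarrow> complex ^ 'n"
  assumes "i \<notin> J"
  obtains v where "v \<noteq> 0" "\<forall>j\<in>J. cip (e j) v = 0"
proof -
  define M :: "'n cmat" where "M = (\<chi> j k. if j \<in> J then cnj (e j $ k) else 0)"
  have "\<not> invertible M"
  proof
    assume "invertible M"
    then obtain N where N: "M ** N = mat 1"
      by (auto simp: invertible_def)
    have "(M ** N) $ i $ i = 0"
      using assms by (simp add: M_def matrix_matrix_mult_def)
    with N show False
      by (simp add: mat_def)
  qed
  then obtain v where "v \<noteq> 0" and Mv: "M *v v = 0"
    using invertible_left_inverse matrix_left_invertible_ker by blast
  have "cip (e j) v = 0" if "j \<in> J" for j
  proof -
    have "(M *v v) $ j = 0"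
      by (simp add: Mv)
    with that show ?thesis
      by (simp add: M_def matrix_vector_mult_def cip_def)
  qed
  with \<open>v \<noteq> 0\<close> show thesis
    using that by blast
qed

lemma continuous_on_cip [continuous_intros]:
  assumes "continuous_on S f" "continuous_on S g"
  shows "continuous_on S (\<lambda>x. cip (f x) (g x))"
  unfolding cip_def by (intro continuous_intros assms)

text \<open>A maximizer \<open>v\<close> of the quadratic form on the unit sphere of an invariant subspace \<open>V\<close> is an
  eigenvector: for the maximum \<open>\<mu>\<close>, the form of \<open>\<mu> - A\<close> is nonnegative on \<open>V\<close> and vanishes at
  \<open>v\<close>, so \<open>(\<mu> - A) v\<close> is orthogonal to \<open>V\<close>.\<close>

lemma exists_orthogonal_eigenvector:
  fixes A :: "'n::finite cmat"
  assumes herm: "dagger A = A"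
    and eig: "\<forall>j\<in>J. A *v e j = complex_of_real (d j) *s e j"
    and u: "u \<noteq> 0" "\<forall>j\<in>J. cip (e j) u = 0"
  obtains v \<mu> where "norm v = 1" "\<forall>j\<in>J. cip (e j) v = 0" "A *v v = complex_of_real \<mu> *s v"
proof -
  define V where "V = {v. \<forall>j\<in>J. cip (e j) v = 0}"
  define q where "q v = Re (cip v (A *v v))" for v
  have V_scale: "c *s v \<in> V" if "v \<in> V" for c v
    using that by (simp add: V_def cip_scale_right)
  have V_add: "v + w \<in> V" if "v \<in> V" "w \<in> V" for v w
    using that by (simp add: V_def cip_add_right)
  have V_diff: "v - w \<in> V" if "v \<in> V" "w \<in> V" for v w
    using that by (simp add: V_def cip_diff_right)
  \<comment> \<open>Moving the Hermitian \<open>A\<close> onto the eigenvector \<open>e j\<close>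
    only produces a scalar, so the orthogonal complement is invariant.\<close>
  have V_mult: "A *v v \<in> V" if "v \<in> V" for v
    using that eig by (auto simp: V_def cip_hermitian[OF herm, symmetric] cip_scale_left)
  have norm_scale: "norm (complex_of_real r *s v) = \<bar>r\<bar> * norm v" for r and v :: "complex ^ 'n"
  proof -
    have "complex_of_real r *s v = r *\<^sub>R v"
      by (simp add: vec_eq_iff scaleR_conv_of_real[where 'a = complex])
    then show ?thesis by simp
  qed
  have q_scale: "q (complex_of_real r *s v) = r\<^sup>2 * q v" for r v
    by (simp add: q_def vector_mult_scale cip_scale_left cip_scale_right power2_eq_square)
  have "closed V"
  proof -
    have "V = (\<Inter>j\<in>J. {v. cip (e j) v = 0})"
      by (auto simp: V_def)
    then show ?thesis
      by (simp add: closed_INT closed_Collect_eq continuous_on_cip)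
  qed
  then have "compact (V \<inter> sphere 0 1)"
    by (simp add: closed_Int_compact)
  moreover have "complex_of_real (1 / norm u) *s u \<in> V \<inter> sphere 0 1"
    using u V_scale[of u] norm_scale[of "1 / norm u" u] by (simp add: V_def)
  moreover have "continuous_on (V \<inter> sphere 0 1) q"
    unfolding q_def by (intro continuous_intros)
  ultimately obtain v where v: "v \<in> V" "norm v = 1"
    and max: "\<And>w. w \<in> V \<Longrightarrow> norm w = 1 \<Longrightarrow> q w \<le> q v"
    using continuous_attains_sup[of "V \<inter> sphere 0 1" q]
    by (metis IntE IntI emptyE mem_sphere_0)
  define \<mu> where "\<mu> = q v"
  have bound: "q w \<le> \<mu> * (norm w)\<^sup>2" if "w \<in> V" for w
  proof (cases "w = 0")
    case True
    then show ?thesis by (simp add: q_def)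
  next
    case False
    have "q (complex_of_real (1 / norm w) *s w) \<le> \<mu>"
      unfolding \<mu>_def using that False norm_scale[of "1 / norm w" w] by (intro max V_scale) simp_all
    then show ?thesis
      using False unfolding q_scale by (simp add: field_simps power2_eq_square)
  qed
  define g where "g = complex_of_real \<mu> *s v - A *v v"
  have "g \<in> V"
    unfolding g_def by (intro V_diff V_scale V_mult v)
  \<comment> \<open>This is \<open>bound\<close> along the line through \<open>v\<close> in the
    direction of the residual \<open>g\<close>. The zeroth-order terms cancel, and the slope at
    \<open>t = 0\<close> is a multiple of the squared norm of \<open>g\<close>, so it must
    vanish.\<close>
  have quad: "0 \<le> 2 * t * (norm g)\<^sup>2 + t\<^sup>2 * (\<mu> * (norm g)\<^sup>2 - q g)" for t :: real
  proof -
    define w where "w = v + complex_of_real t *s g"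
    have "w \<in> V"
      unfolding w_def by (intro V_add V_scale v \<open>g \<in> V\<close>)
    have 1: "(norm w)\<^sup>2 = 1 + 2 * t * Re (cip g v) + t\<^sup>2 * (norm g)\<^sup>2"
      using hermitian_quadratic_line[of "mat 1" v t g] v
      by (simp add: w_def cip_self dagger_mat_1 del: of_real_power)
    have 2: "q w = \<mu> + 2 * t * Re (cip g (A *v v)) + t\<^sup>2 * q g"
      unfolding w_def q_def \<mu>_def by (rule hermitian_quadratic_line[OF herm])
    have "(norm g)\<^sup>2 = Re (cip g (complex_of_real \<mu> *s v - A *v v))"
      by (simp add: cip_self flip: g_def)
    then have 3: "Re (cip g (A *v v)) = \<mu> * Re (cip g v) - (norm g)\<^sup>2"
      by (simp add: cip_diff_right cip_scale_right)
    show ?thesis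
      using bound[OF \<open>w \<in> V\<close>] unfolding 1 2 3 by (simp add: algebra_simps)
  qed
  have "(norm g)\<^sup>2 = 0"
  proof (rule ccontr)
    assume "(norm g)\<^sup>2 \<noteq> 0"
    then have a: "0 < (norm g)\<^sup>2" by simp
    define b where "b = \<mu> * (norm g)\<^sup>2 - q g"
    have b: "0 \<le> b"
      using bound[OF \<open>g \<in> V\<close>] by (simp add: b_def)
    \<comment> \<open>A negative \<open>t\<close> small enough for the linear term to beat the
      quadratic one; the \<open>+ 1\<close> keeps the denominator positive when
      \<open>b = 0\<close>.\<close>
    define t where "t = - (norm g)\<^sup>2 / (b + 1)"
    have t: "t < 0" "t * (b + 1) = - (norm g)\<^sup>2"
      using a b by (simp_all add: t_def divide_neg_pos)
    have "2 * t * (norm g)\<^sup>2 + t\<^sup>2 * b = t * ((norm g)\<^sup>2 - t)"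
      using t(2) by algebra
    also have "\<dots> < 0"
      using a t(1) by (intro mult_neg_pos) linarith+
    finally show False
      using quad[of t] by (simp add: b_def)
  qed
  then have "A *v v = complex_of_real \<mu> *s v"
    by (simp add: g_def)
  with v show thesis
    using that by (simp add: V_def)
qed

text \<open>Induction on the set of indices already served: as long as an index is missing, the
  orthogonal complement is nonzero and contains a further unit eigenvector.\<close>

theorem hermitian_eigenbasis:
  fixes A :: "'n::finite cmat"
  assumes "dagger A = A"
  obtains e d where "eigenbasis A e d"
proof -
  have "\<exists>e d. orthonormal_on J e \<and> (\<forall>i\<in>J. A *v e i = complex_of_real (d i) *s e i)" for J :: "'n set"
    using finite[of J]
  proof (induction J)
    case empty
    then show ?case by (simp add: orthonormal_on_def)
  next
    case (insert i J)
    then obtain e d where orth: "orthonormal_on J e"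
      and eig: "\<forall>j\<in>J. A *v e j = complex_of_real (d j) *s e j" by blast
    obtain u where "u \<noteq> 0" "\<forall>j\<in>J. cip (e j) u = 0"
      using exists_orthogonal_vector[OF insert.hyps(2)] by blast
    then obtain v \<mu> where v: "norm v = 1" "\<forall>j\<in>J. cip (e j) v = 0" "A *v v = complex_of_real \<mu> *s v"
      using exists_orthogonal_eigenvector[OF assms eig] by blast
    have "\<forall>j\<in>J. cip v (e j) = 0"
      using v(2) cip_commute by (metis complex_cnj_zero)
    then have "orthonormal_on (insert i J) (e(i := v))"
      using orth v cip_self[of v] insert.hyps by (auto simp: orthonormal_on_def)
    moreover have "\<forall>j\<in>insert i J. A *v (e(i := v)) j = complex_of_real ((d(i := \<mu>)) j) *s (e(i := v)) j"
      using eig v(3) by auto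
    ultimately show ?case by blast
  qed
  from this[of UNIV] show thesis
    using that by auto
qed

section \<open>The trace norm of a Hermitian matrix\<close>

text \<open>Since \<open>(B + \<mu>) (B - \<mu>) v = 0\<close>, the vector
  \<open>w = (B - \<mu>) v\<close> satisfies \<open>B w = - \<mu> w\<close>, which positivity of
  \<open>B\<close> excludes unless \<open>w = 0\<close> or \<open>\<mu> = 0\<close>.\<close>

lemma psd_square_root_eigenvector:
  assumes "psd B" "0 \<le> \<mu>" and sq: "B *v (B *v v) = complex_of_real (\<mu>\<^sup>2) *s v"
  shows "B *v v = complex_of_real \<mu> *s v"
proof -
  note herm = psd_hermitian[OF \<open>psd B\<close>]
  define w where "w = B *v v - complex_of_real \<mu> *s v"
  have "B *v w = - (complex_of_real \<mu> *s w)"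
    unfolding w_def
    by (simp add: matrix_vector_mult_diff_distrib vector_mult_scale sq vec_eq_iff algebra_simps
        power2_eq_square)
  then have "cip w (B *v w) = - complex_of_real \<mu> * cip w w"
    by (simp add: cip_def sum_negf sum_distrib_left mult_ac)
  then have "Re (cip w (B *v w)) = - \<mu> * (norm w)\<^sup>2"
    by (simp add: cip_self)
  then have "\<mu> * (norm w)\<^sup>2 \<le> 0"
    using psd_Re_nonneg[OF \<open>psd B\<close>, of w] by simp
  then have *: "\<mu> = 0 \<or> w = 0"
    using \<open>0 \<le> \<mu>\<close> by (auto simp: mult_le_0_iff)
  \<comment> \<open>In the degenerate case \<open>w = B v\<close>, and its squared norm is the
    expectation of \<open>B ** B\<close> in \<open>v\<close>, which is zero.\<close>
  moreover have "w = 0" if "\<mu> = 0"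
  proof -
    have "cip (B *v v) (B *v v) = 0"
      using that sq by (simp add: cip_hermitian[OF herm])
    then show ?thesis
      using that by (simp add: cip_self_eq_0_iff w_def)
  qed
  ultimately have "w = 0" by blast
  then show ?thesis by (simp add: w_def)
qed

text \<open>Every eigenvector of \<open>C\<close> is one of \<open>C ** C = B ** B\<close>, hence of
  \<open>B\<close> with the same nonnegative eigenvalue; so \<open>B\<close> and \<open>C\<close>
  agree on an eigenbasis. This makes the definite description in \<open>psd_sqrt\<close>
  usable.\<close>

lemma psd_square_root_unique:
  assumes "psd B" "psd C" "B ** B = C ** C"
  shows "B = C"
proof -
  obtain e d where ed: "eigenbasis C e d"
    using hermitian_eigenbasis[OF psd_hermitian[OF \<open>psd C\<close>]] .
  have "B *v e i = C *v e i" for i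
  proof -
    have "0 \<le> d i"
      using psd_Re_nonneg[OF \<open>psd C\<close>, of "e i"] eigenbasis_eigenvalue[OF ed, of i] by simp
    moreover have "B *v (B *v e i) = complex_of_real ((d i)\<^sup>2) *s e i"
      using ed assms(3)
      by (simp add: matrix_vector_mul_assoc)
         (simp add: vector_mult_scale power2_eq_square flip: matrix_vector_mul_assoc)
    ultimately show ?thesis
      using psd_square_root_eigenvector[OF \<open>psd B\<close>] ed by simp
  qed
  with ed show ?thesis
    using matrix_eq_on_orthonormal by blast
qed

text \<open>The absolute value of \<open>H\<close>, assembled as \<open>B\<close> from the spectral
  decomposition, is a positive semidefinite root of \<open>dagger H ** H\<close>; uniqueness
  identifies it with \<open>psd_sqrt\<close>.\<close>

lemma trace_norm_eigenbasis:
  assumes herm: "dagger H = H" and ed: "eigenbasis H e d"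
  shows "trace_norm H = (\<Sum>k\<in>UNIV. \<bar>d k\<bar>)"
proof -
  define B where "B = (\<Sum>k\<in>UNIV. mscale (complex_of_real \<bar>d k\<bar>) (ketbra (e k)))"
  have Bv: "B *v v = (\<Sum>k\<in>UNIV. (complex_of_real \<bar>d k\<bar> * cip (e k) v) *s e k)" for v
  proof -
    have "(\<Sum>k\<in>S. M k) *v v = (\<Sum>k\<in>S. M k *v v)" for S and M :: "'a \<Rightarrow> 'a cmat"
      by (induction S rule: infinite_finite_induct) (simp_all add: matrix_vector_mult_add_rdistrib)
    then show ?thesis
      by (simp add: B_def mscale_vector_mult ketbra_vector_mult)
  qed
  have Be: "B *v e i = complex_of_real \<bar>d i\<bar> *s e i" for i
  proof -
    have "(complex_of_real \<bar>d k\<bar> * cip (e k) (e i)) *s e k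
        = (if k = i then complex_of_real \<bar>d i\<bar> *s e i else 0)" for k
      using ed by (simp add: orthonormal_on_def)
    then show ?thesis
      by (simp add: Bv)
  qed
  with ed have eB: "eigenbasis B e (\<lambda>i. \<bar>d i\<bar>)" by simp
  have "psd B"
    by (rule psdI[OF eigenbasis_cip[OF eB]]) (simp add: sum_nonneg)
  have sq: "B ** B = dagger H ** H"
  proof (rule matrix_eq_on_orthonormal)
    show "orthonormal_on UNIV e" using ed by simp
    show "(B ** B) *v e i = (dagger H ** H) *v e i" for i
      using ed by (simp add: herm Be vector_mult_scale flip: matrix_vector_mul_assoc of_real_mult)
  qed
  have "psd_sqrt (dagger H ** H) = B"
    unfolding psd_sqrt_def
  proof (rule the_equality)
    show "psd B \<and> B ** B = dagger H ** H"
      using \<open>psd B\<close> sq by blast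
    show "C = B" if "psd C \<and> C ** C = dagger H ** H" for C
      by (rule psd_square_root_unique) (use that \<open>psd B\<close> sq in \<open>simp_all only:\<close>)
  qed
  then show ?thesis
    unfolding trace_norm_def by (simp add: eigenbasis_trace[OF eB])
qed

text \<open>In an eigenbasis of the difference, each eigenvalue is a difference of two nonnegative
  expectations, so its modulus is at most their sum. This bounds the error of the explicit
  protocol.\<close>

lemma trace_norm_psd_diff:
  assumes "psd A" "psd C"
  shows "trace_norm (A - C) \<le> Re (trace A) + Re (trace C)"
proof -
  have herm: "dagger (A - C) = A - C"
    using assms by (simp add: dagger_diff psd_hermitian)
  obtain e d where ed: "eigenbasis (A - C) e d"
    using hermitian_eigenbasis[OF herm] .
  have "\<bar>d k\<bar> \<le> Re (cip (e k) (A *v e k)) + Re (cip (e k) (C *v e k))" for k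
    using eigenbasis_eigenvalue[OF ed, of k] psd_Re_nonneg[OF assms(1), of "e k"]
      psd_Re_nonneg[OF assms(2), of "e k"]
    by (auto simp: matrix_vector_mult_diff_rdistrib cip_diff_right complex_eq_iff)
  then have "(\<Sum>k\<in>UNIV. \<bar>d k\<bar>)
      \<le> (\<Sum>k\<in>UNIV. Re (cip (e k) (A *v e k)) + Re (cip (e k) (C *v e k)))"
    by (intro sum_mono)
  also have "\<dots> = Re (trace A) + Re (trace C)"
    using ed by (simp add: orthonormal_trace[of e] sum.distrib)
  finally show ?thesis
    by (simp add: trace_norm_eigenbasis[OF herm ed])
qed

lemma eigenbasis_weight_le_1:
  assumes "orthonormal_on UNIV (e :: 'n::finite \<Rightarrow> complex ^ 'n)" "norm v = 1"
  shows "(cmod (cip (e k) v))\<^sup>2 \<le> 1"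
proof -
  have "(cmod (cip (e k) v))\<^sup>2 \<le> (\<Sum>k\<in>UNIV. (cmod (cip (e k) v))\<^sup>2)"
    by (intro member_le_sum) auto
  then show ?thesis
    using assms by (simp add: orthonormal_parseval)
qed

text \<open>The expectation weights the eigenvalues by numbers in \<open>[0, 1]\<close>, so it is at
  least the sum of the negative eigenvalues. As the trace vanishes, that sum is minus half the trace
  norm.\<close>

lemma traceless_expectation_ge:
  assumes herm: "dagger H = H" and "trace H = 0" "norm v = 1"
  shows "- (1 / 2 * trace_norm H) \<le> Re (cip v (H *v v))"
proof -
  obtain e d where ed: "eigenbasis H e d"
    using hermitian_eigenbasis[OF herm] .
  have "(\<Sum>k\<in>UNIV. d k) = 0"
    using eigenbasis_trace[OF ed] \<open>trace H = 0\<close> by (metis of_real_eq_0_iff)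
  \<comment> \<open>\<open>(d k - \<bar>d k\<bar>) / 2\<close> is the minimum of \<open>d k\<close>
    and 0.\<close>
  then have "- (1 / 2 * trace_norm H) = (\<Sum>k\<in>UNIV. (d k - \<bar>d k\<bar>) / 2)"
    by (simp add: trace_norm_eigenbasis[OF herm ed] sum_subtractf flip: sum_divide_distrib)
  also have "\<dots> \<le> (\<Sum>k\<in>UNIV. d k * (cmod (cip (e k) v))\<^sup>2)"
  proof (rule sum_mono)
    fix k
    define w where "w = (cmod (cip (e k) v))\<^sup>2"
    have w: "0 \<le> w" "w \<le> 1"
      using eigenbasis_weight_le_1[of e v k] ed \<open>norm v = 1\<close> by (simp_all add: w_def)
    have "(d k - \<bar>d k\<bar>) / 2 \<le> d k * w"
    proof (cases "0 \<le> d k")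
      case True
      then show ?thesis using w by simp
    next
      case False
      then show ?thesis
        using w mult_left_mono_neg[of w 1 "d k"] by simp
    qed
    then show "(d k - \<bar>d k\<bar>) / 2 \<le> d k * (cmod (cip (e k) v))\<^sup>2"
      by (simp add: w_def)
  qed
  also have "\<dots> = Re (cip v (H *v v))"
    by (simp add: eigenbasis_cip[OF ed])
  finally show ?thesis .
qed

lemma psd_expectation_le_trace:
  assumes "psd A" "norm v = 1"
  shows "Re (cip v (A *v v)) \<le> Re (trace A)"
proof -
  obtain e d where ed: "eigenbasis A e d"
    using hermitian_eigenbasis[OF psd_hermitian[OF \<open>psd A\<close>]] .
  have "Re (cip v (A *v v)) = (\<Sum>k\<in>UNIV. d k * (cmod (cip (e k) v))\<^sup>2)"
    by (simp add: eigenbasis_cip[OF ed])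
  also have "\<dots> \<le> (\<Sum>k\<in>UNIV. d k * 1)"
  proof (intro sum_mono mult_left_mono)
    fix k
    show "(cmod (cip (e k) v))\<^sup>2 \<le> 1"
      using eigenbasis_weight_le_1 ed \<open>norm v = 1\<close> by blast
    show "0 \<le> d k"
      using psd_Re_nonneg[OF \<open>psd A\<close>, of "e k"] eigenbasis_eigenvalue[OF ed, of k] by simp
  qed
  finally show ?thesis
    by (simp add: eigenbasis_trace[OF ed])
qed

section \<open>Tensor powers and operations\<close>

text \<open>Turns the tensor power of a rank-one projector into the projector of a single product
  vector, so that all facts about \<open>ketbra\<close> apply to the target.\<close>

definition vec_tensor_pow :: "complex ^ 'n::finite \<Rightarrow> complex ^ ('m::finite \<Rightarrow> 'n)"
  where "vec_tensor_pow v = (\<chi> f. \<Prod>k\<in>UNIV. v $ f k)"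

lemma tensor_pow_ketbra: "tensor_pow (ketbra v) = ketbra (vec_tensor_pow v)"
  by (simp add: tensor_pow_def ketbra_def vec_tensor_pow_def prod.distrib vec_eq_iff)

lemma norm_vec_tensor_pow:
  "norm (vec_tensor_pow v :: complex ^ ('m::finite \<Rightarrow> 'n::finite)) = norm v ^ CARD('m)"
proof -
  have sq: "(norm w)\<^sup>2 = (\<Sum>i\<in>UNIV. (cmod (w $ i))\<^sup>2)" for w :: "complex ^ 'k::finite"
    by (simp add: norm_vec_def L2_set_def sum_nonneg)
  have "(norm (vec_tensor_pow v :: complex ^ ('m \<Rightarrow> 'n)))\<^sup>2
      = (\<Sum>f\<in>(UNIV :: ('m \<Rightarrow> 'n) set). \<Prod>k\<in>UNIV. (cmod (v $ f k))\<^sup>2)"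
    by (simp add: sq vec_tensor_pow_def prod_norm[symmetric] prod_power_distrib)
  \<comment> \<open>Distributivity: a sum over all functions of a product is the product of the
    sums.\<close>
  also have "\<dots> = (\<Prod>k\<in>(UNIV :: 'm set). \<Sum>i\<in>UNIV. (cmod (v $ i))\<^sup>2)"
    by (subst prod_sum_PiE) (simp_all add: PiE_UNIV_domain)
  also have "\<dots> = (norm v ^ CARD('m))\<^sup>2"
    by (simp add: sq[symmetric] flip: power_mult) (simp add: mult.commute)
  finally show ?thesis
    by (simp add: power2_eq_iff_nonneg)
qed

lemma cptp_density_op:
  assumes "cptp \<Lambda>" "density_op \<rho>"
  shows "density_op (\<Lambda> \<rho>)"
proof -
  \<comment> \<open>Plain positivity is complete positivity with a single block.\<close>
  have block_1: "block_psd 1 (\<lambda>a b. X) \<longleftrightarrow> psd X" for X :: "'k::finite cmat"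
    unfolding block_psd_def psd_def by (auto dest: spec[where x = "\<lambda>_. _"])
  have "psd (\<Lambda> \<rho>)"
  proof -
    have "block_psd 1 (\<lambda>a b. \<Lambda> \<rho>)"
      using assms iffD2[OF block_1, of \<rho>]
      by (simp only: cptp_def completely_positive_def density_op_def)
    then show ?thesis
      by (rule iffD1[OF block_1])
  qed
  then show ?thesis
    using assms by (simp add: cptp_def density_op_def)
qed

text \<open>The twirl sees its input only through the overlap with \<open>u\<close> and the
  trace.\<close>

lemma twirl_ketbra:
  "twirl (ketbra u) \<sigma> X
    = mscale (cip u (X *v u)) (ketbra u) + mscale (trace X - cip u (X *v u)) \<sigma>"
proof -
  have "trace ((mat 1 - ketbra u) ** X) = trace X - cip u (X *v u)"
  proof -
    have "(mat 1 - ketbra u) ** X = X - ketbra u ** X"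
      by (simp add: matrix_eq matrix_vector_mult_diff_rdistrib flip: matrix_vector_mul_assoc)
    then show ?thesis
      by (simp add: trace_diff trace_ketbra_mult)
  qed
  then show ?thesis
    by (simp add: twirl_def trace_ketbra_mult)
qed

theorem theorem2:
  fixes \<psi> :: "complex ^ 'n::finite"
    and \<rho> :: "'i::finite cmat"
    and \<epsilon> :: real
    and F_in :: "'i cmat set"
    and F_out :: "('m::finite \<Rightarrow> 'n) cmat set"
    and O_in_out :: "('i cmat \<Rightarrow> ('m \<Rightarrow> 'n) cmat) set"
    and O_out_out :: "(('m \<Rightarrow> 'n) cmat \<Rightarrow> ('m \<Rightarrow> 'n) cmat) set"
  assumes target: "norm \<psi> = 1"
    and error: "0 \<le> \<epsilon>" "\<epsilon> < 1"
    and state: "density_op \<rho>"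
    and free_in_out: "free_operations F_in F_out O_in_out"
    and free_out_out: "free_operations F_out F_out O_out_out"
    and composition: "\<And>\<Lambda> \<Theta>. \<Lambda> \<in> O_in_out \<Longrightarrow> \<Theta> \<in> O_out_out \<Longrightarrow> \<Theta> \<circ> \<Lambda> \<in> O_in_out"
    and preparation: "\<And>\<sigma>. \<sigma> \<in> F_out \<Longrightarrow> prepare \<sigma> \<in> O_in_out"
    and twirling: "\<exists>\<sigma>\<in>F_out. twirl (tensor_pow (ketbra \<psi>)) \<sigma> \<in> O_out_out"
  shows "virtual_overhead O_in_out \<psi> \<epsilon> \<rho> =
    max (ereal (2 * (1 - \<epsilon>)) / max_overlap O_in_out \<psi> \<rho> - 1) 1"
proof -
  define \<Psi> where "\<Psi> = (vec_tensor_pow \<psi> :: complex ^ ('m \<Rightarrow> 'n))"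
  define P where "P = ketbra \<Psi>"
  define p where "p \<Lambda> = Re (cip \<Psi> (\<Lambda> \<rho> *v \<Psi>))" for \<Lambda> :: "'i cmat \<Rightarrow> ('m \<Rightarrow> 'n) cmat"
  define V where "V = virtual_overhead O_in_out \<psi> \<epsilon> \<rho>"
  define f where "f = max_overlap O_in_out \<psi> \<rho>"
  have P: "tensor_pow (ketbra \<psi>) = P"
    by (simp add: P_def \<Psi>_def tensor_pow_ketbra)
  have norm: "norm \<Psi> = 1"
    using target by (simp add: \<Psi>_def norm_vec_tensor_pow)
  have dens_P: "density_op P"
    by (simp add: P_def density_op_def psd_ketbra trace_ketbra norm)
  have cip_P: "cip \<Psi> (P *v \<Psi>) = 1"
    by (simp add: P_def ketbra_vector_mult cip_scale_right cip_self norm)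
  have dens: "density_op (\<Lambda> \<rho>)" if "\<Lambda> \<in> O_in_out" for \<Lambda>
    using that free_in_out state by (auto simp: free_operations_def intro: cptp_density_op)
  have p0: "0 \<le> p \<Lambda>" if "\<Lambda> \<in> O_in_out" for \<Lambda>
    using dens[OF that] psd_Re_nonneg by (simp add: p_def density_op_def psd_Re_nonneg)
  have p1: "p \<Lambda> \<le> 1" if "\<Lambda> \<in> O_in_out" for \<Lambda>
    using dens[OF that] psd_expectation_le_trace[OF _ norm, of "\<Lambda> \<rho>"]
    by (simp add: p_def density_op_def)
  have f_eq: "f = (SUP \<Lambda>\<in>O_in_out. ereal (p \<Lambda>))"
    unfolding f_def max_overlap_def P p_def P_def
    by (simp add: trace_mul_sym[of "_ \<rho>"] trace_ketbra_mult)
  obtain \<sigma> where \<sigma>: "\<sigma> \<in> F_out" and twirl: "twirl P \<sigma> \<in> O_out_out"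
    using twirling by (auto simp: P)
  have dens_\<sigma>: "density_op \<sigma>"
    using \<sigma> free_in_out by (simp add: free_operations_def)
  \<comment> \<open>This operation will serve as \<open>\<Lambda>m\<close>. It also shows that
    \<open>O_in_out\<close> is nonempty, so the supremum \<open>f\<close> is not minus
    infinity.\<close>
  have prep: "prepare \<sigma> \<in> O_in_out" "prepare \<sigma> \<rho> = \<sigma>"
    using preparation[OF \<sigma>] state by (simp_all add: prepare_def density_op_def mscale_def)
  have f0: "0 \<le> f"
    unfolding f_eq using p0[OF prep(1)] by (intro SUP_upper2[OF prep(1)]) simp
  have f1: "f \<le> 1"
    unfolding f_eq using p1 by (intro SUP_least) (simp add: one_ereal_def)
  obtain r where r: "f = ereal r" "0 \<le> r" "r \<le> 1"
    using f0 f1 by (cases f) (auto simp: one_ereal_def)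
  have p_le: "p \<Lambda> \<le> r" if "\<Lambda> \<in> O_in_out" for \<Lambda>
    using SUP_upper[of \<Lambda> O_in_out "\<lambda>\<Lambda>. ereal (p \<Lambda>)"] that by (simp add: f_eq[symmetric] r)

  have converse: "1 \<le> lp + lm \<and> 1 - \<epsilon> \<le> lp * r"
    if l: "0 \<le> lp" "0 \<le> lm" "lp - lm = 1" and \<Lambda>: "\<Lambda>p \<in> O_in_out" "\<Lambda>m \<in> O_in_out"
      and close: "1 / 2 * trace_norm (lp *\<^sub>R \<Lambda>p \<rho> - lm *\<^sub>R \<Lambda>m \<rho> - P) \<le> \<epsilon>"
    for lp lm :: real and \<Lambda>p \<Lambda>m
  proof
    show "1 \<le> lp + lm" using l by simp
    define H where "H = lp *\<^sub>R \<Lambda>p \<rho> - lm *\<^sub>R \<Lambda>m \<rho> - P"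
    have "dagger H = H"
      using dens[OF \<Lambda>(1)] dens[OF \<Lambda>(2)] dens_P
      by (simp add: H_def dagger_diff dagger_scaleR psd_hermitian density_op_def)
    moreover have "trace H = complex_of_real (lp - lm - 1)"
      using dens[OF \<Lambda>(1)] dens[OF \<Lambda>(2)] dens_P
      by (simp add: H_def trace_diff trace_scaleR density_op_def)
    then have "trace H = 0" using l by simp
    ultimately have "- \<epsilon> \<le> Re (cip \<Psi> (H *v \<Psi>))"
      using traceless_expectation_ge[OF _ _ norm, of H] close by (simp add: H_def)
    also have "\<dots> = lp * p \<Lambda>p - lm * p \<Lambda>m - 1"
      by (simp add: H_def p_def matrix_vector_mult_diff_rdistrib cip_diff_right cip_P
          scaleR_eq_mscale mscale_vector_mult cip_scale_right)
    also have "\<dots> \<le> lp * r - 1"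
      using mult_left_mono[OF p_le[OF \<Lambda>(1)] l(1)] mult_nonneg_nonneg[OF l(2) p0[OF \<Lambda>(2)]] by simp
    finally show "1 - \<epsilon> \<le> lp * r" by simp
  qed

  \<comment> \<open>Stated for every operation of positive overlap, since the supremum
    \<open>f\<close> is not assumed to be attained.\<close>
  have achievable: "V \<le> ereal (max (2 * (1 - \<epsilon>) / p \<Lambda> - 1) 1)"
    if \<Lambda>: "\<Lambda> \<in> O_in_out" and pos: "0 < p \<Lambda>" for \<Lambda>
  proof -
    define \<Theta> where "\<Theta> = twirl P \<sigma> \<circ> \<Lambda>"
    \<comment> \<open>The cap at 1 makes \<open>lp - 1\<close> an admissible negative weight. It
      also gives \<open>lp * p \<Lambda> = max (1 - \<epsilon>) (p \<Lambda>)\<close>, which places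
      the defect \<open>c\<close> between 0 and \<open>\<epsilon>\<close>.\<close>
    define lp where "lp = max ((1 - \<epsilon>) / p \<Lambda>) 1"
    define c where "c = 1 - lp * p \<Lambda>"
    have "lp * p \<Lambda> = max (1 - \<epsilon>) (p \<Lambda>)"
      using pos by (simp add: lp_def max_mult_distrib_right)
    then have c: "0 \<le> c" "c \<le> \<epsilon>"
      using error p1[OF \<Lambda>] by (auto simp: c_def)
    have lp: "1 \<le> lp" by (simp add: lp_def)
    have "psd (\<Lambda> \<rho>)" "trace (\<Lambda> \<rho>) = 1"
      using dens[OF \<Lambda>] by (simp_all add: density_op_def)
    then have \<Theta>: "\<Theta> \<rho> = p \<Lambda> *\<^sub>R P + (1 - p \<Lambda>) *\<^sub>R \<sigma>"
      using psd_cip[of "\<Lambda> \<rho>" \<Psi>] by (simp add: \<Theta>_def P_def twirl_ketbra p_def scaleR_eq_mscale)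
    have "lp *\<^sub>R \<Theta> \<rho> - (lp - 1) *\<^sub>R prepare \<sigma> \<rho> - P = c *\<^sub>R \<sigma> - c *\<^sub>R P"
      unfolding \<Theta> prep(2) c_def by (simp add: algebra_simps)
    then have "trace_norm (lp *\<^sub>R \<Theta> \<rho> - (lp - 1) *\<^sub>R prepare \<sigma> \<rho> - P) \<le> 2 * c"
      using trace_norm_psd_diff[of "c *\<^sub>R \<sigma>" "c *\<^sub>R P"] dens_\<sigma> dens_P c
      by (simp add: density_op_def psd_scaleR trace_scaleR)
    moreover have "\<Theta> \<in> O_in_out"
      unfolding \<Theta>_def by (rule composition[OF \<Lambda> twirl])
    ultimately have "V \<le> ereal (lp + (lp - 1))"
      unfolding V_def virtual_overhead_def P using lp c prep(1)
      by (intro Inf_lower CollectI exI[of _ lp] exI[of _ "lp - 1"] exI[of _ \<Theta>]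
          exI[of _ "prepare \<sigma>"]) auto
    also have "lp + (lp - 1) = max (2 * (1 - \<epsilon>) / p \<Lambda> - 1) 1"
      using pos by (auto simp add: lp_def max_def field_simps)
    finally show ?thesis .
  qed

  have "V = max (ereal (2 * (1 - \<epsilon>)) / f - 1) 1"
  proof (cases "r = 0")
    case True
    \<comment> \<open>With \<open>r = 0\<close>, a feasible decomposition would force
      \<open>1 - \<epsilon> \<le> 0\<close>; the infimum is over the empty set.\<close>
    have "{ereal (lp + lm) | lp lm \<Lambda>p \<Lambda>m.
      0 \<le> lp \<and> 0 \<le> lm \<and> lp - lm = 1 \<and> \<Lambda>p \<in> O_in_out \<and> \<Lambda>m \<in> O_in_out \<and>
      1 / 2 * trace_norm (lp *\<^sub>R \<Lambda>p \<rho> - lm *\<^sub>R \<Lambda>m \<rho> - P) \<le> \<epsilon>} = {}"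
      using converse error True by fastforce
    then have "V = \<infinity>"
      unfolding V_def virtual_overhead_def P by (simp only: Inf_empty top_ereal_def)
    moreover have "ereal (2 * (1 - \<epsilon>)) / f = \<infinity>"
      using ereal_pos_divide_zero[of "2 * (1 - \<epsilon>)"] error r True by (simp add: zero_ereal_def)
    ultimately show ?thesis by simp
  next
    case False
    with r have "0 < r" by simp
    define M where "M = max (2 * (1 - \<epsilon>) / r - 1) 1"
    have M: "max (ereal (2 * (1 - \<epsilon>)) / f - 1) 1 = ereal M"
      using \<open>0 < r\<close> by (simp add: r M_def one_ereal_def)
    have lower: "ereal M \<le> V"
      unfolding V_def virtual_overhead_def P
    proof (rule Inf_greatest, clarify)
      fix lp lm \<Lambda>p \<Lambda>m
      assume l: "0 \<le> lp" "0 \<le> lm" "lp - lm = 1" and \<Lambda>: "\<Lambda>p \<in> O_in_out" "\<Lambda>m \<in> O_in_out"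
        and close: "1 / 2 * trace_norm (lp *\<^sub>R \<Lambda>p \<rho> - lm *\<^sub>R \<Lambda>m \<rho> - P) \<le> \<epsilon>"
      have *: "1 \<le> lp + lm" "1 - \<epsilon> \<le> lp * r"
        using converse[OF l \<Lambda> close] by auto
      \<comment> \<open>\<open>lp - lm = 1\<close> turns a lower bound on \<open>2 * lp\<close> into
        one on \<open>lp + lm = 2 * lp - 1\<close>.\<close>
      then have "2 * ((1 - \<epsilon>) / r) \<le> 2 * lp"
        using \<open>0 < r\<close> by (simp add: divide_le_eq)
      then have "2 * (1 - \<epsilon>) / r - 1 \<le> lp + lm"
        unfolding times_divide_eq_right using l by linarith
      with * show "ereal M \<le> ereal (lp + lm)"
        by (simp add: M_def)
    qed
    have upper: "V \<le> ereal M"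
    proof (rule ccontr)
      assume "\<not> V \<le> ereal M"
      \<comment> \<open>A real number strictly between replaces the limit along operations
        approaching the supremum: it bounds every overlap by the same constant, hence also
        \<open>r\<close>.\<close>
      then obtain v where v: "M < v" "ereal v < V"
        using ereal_dense2[of "ereal M" V] by (auto simp: not_le)
      then have "1 < v" by (simp add: M_def)
      have "p \<Lambda> \<le> 2 * (1 - \<epsilon>) / (v + 1)" if "\<Lambda> \<in> O_in_out" for \<Lambda>
      proof (cases "0 < p \<Lambda>")
        case True
        have "ereal v < ereal (max (2 * (1 - \<epsilon>) / p \<Lambda> - 1) 1)"
          using v(2) achievable[OF that True] by (rule less_le_trans)
        \<comment> \<open>As \<open>v > 1\<close>, the maximum can exceed \<open>v\<close> only
          through its first argument.\<close>
        then have "v + 1 \<le> 2 * (1 - \<epsilon>) / p \<Lambda>"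
          using \<open>1 < v\<close> by (simp only: less_ereal.simps)
        then show ?thesis
          using True \<open>1 < v\<close> by (simp add: field_simps)
      next
        case False
        moreover have "0 \<le> 2 * (1 - \<epsilon>) / (v + 1)"
          using error \<open>1 < v\<close> by simp
        ultimately show ?thesis by linarith
      qed
      then have "f \<le> ereal (2 * (1 - \<epsilon>) / (v + 1))"
        unfolding f_eq by (intro SUP_least) simp
      then have "r \<le> 2 * (1 - \<epsilon>) / (v + 1)"
        by (simp add: r)
      then have "v \<le> 2 * (1 - \<epsilon>) / r - 1"
        using \<open>0 < r\<close> \<open>1 < v\<close> by (simp add: field_simps)
      then show False
        using v(1) by (simp add: M_def)
    qed
    show ?thesis
      unfolding M using lower upper by (rule antisym[rotated])
  qed
  then show ?thesis
    by (simp add: V_def f_def)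
qed

end
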